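(* Let $p$ be a prime and let $n\ge 0$ be an integer. Then there is a bijection between the set $\mathcal{RG}_{n+1}^{(p)}$ of (labelled) $p$-Riordan graphs with $n+1$ vertices and the set $\mathcal{W}_{n}^{(p)}$ of $p$-Riordan words of length $n$.
   Context: Riordan matrices: for formal power series $g=\sum_{k\ge 0}g_kt^k$ and $f=\sum_{k\ge 1}f_kt^k$ in $\mathbb{Z}[[t]]$ (so $f$ has zero constant term), the Riordan matrix $(g,f)$ is the infinite lower triangular matrix $[\ell_{ij}]_{i,j\ge 0}$ with $\ell_{ij}=[t^i]\,g f^j$, where $[t^k]$ denotes the coefficient of $t^k$. The $m\times m$ leading principal submatrix of $(g,f)$ is denoted $(g,f)_m$. $p$-Riordan graphs: a labelled (weighted) graph $G$ on the vertex set $\{1,\ldots,m\}$, given by its adjacency matrix $A(G)$ with entries in $\{0,1,\ldots,p-1\}$, is a $p$-Riordan graph of order $m$ if there are $g\in\mathbb{Z}[[t]]$ and $f\in t\,\mathbb{Z}[[t]]$ such that $$A(G)\equiv (tg,f)_m+(tg,f)_m^T \pmod p .$$ Equivalently, writing $A(G)=(a_{i,j})_{1\le i,j\le m}$, for all $i\ge j$ one has $a_{i,j}=a_{j,i}\equiv [t^{i-2}]\,g f^{j-1}\pmod p$ (in particular the diagonal is zero). Graphs are labelled: two such graphs are the same if and only if they have the same adjacency matrix. $\mathcal{RG}_m^{(p)}$ denotes the set of all $p$-Riordan graphs with $m$ vertices. $p$-Riordan words: let $A^{(p)}=\{a_{i,j}: 0\le i,j\le p-1\}$ be an alphabet of $p^2$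 distinct letters. A word $w_1w_2\cdots w_n$ over $A^{(p)}$ with $n\ge 1$ is a $p$-Riordan word if either all its letters are $a_{0,0}$, or there exist $i$ and $b$ with $1\le i\le n$ and $1\le b\le p-1$ such that $w_1=\cdots=w_{i-1}=a_{0,0}$ and $w_i=a_{b,0}$ (the remaining letters $w_{i+1},\ldots,w_n$ are arbitrary). The empty word is the $p$-Riordan word of length $0$. $\mathcal{W}_n^{(p)}$ denotes the set of $p$-Riordan words of length $n$. *)

theory Defs
  imports
    "Jordan_Normal_Form.Matrix"
    "HOL-Computational_Algebra.Computational_Algebra"
    "HOL-Number_Theory.Cong"
begin

section \<open>Riordan matrices\<close>

text \<open>Rows and columns are indexed from 0; the matrix is meant for \<open>f\<close> with zero constant term,
  which makes it lower triangular.\<close>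

definition riordan_matrix :: "int fps \<Rightarrow> int fps \<Rightarrow> nat \<Rightarrow> nat \<Rightarrow> int" where
  "riordan_matrix g f i j = fps_nth (g * f ^ j) i"

definition leading_principal :: "(nat \<Rightarrow> nat \<Rightarrow> 'a) \<Rightarrow> nat \<Rightarrow> 'a mat" where
  "leading_principal L m = mat m m (\<lambda>(i, j). L i j)"

section \<open>Riordan graphs\<close>

text \<open>A labelled weighted graph on \<open>{1,\<dots>,m}\<close> is identified with its adjacency matrix. Matrix
  indices start at 0, so vertex \<open>v\<close> corresponds to row and column \<open>v - 1\<close>.\<close>

definition weighted_graphs :: "nat \<Rightarrow> nat \<Rightarrow> int mat set" where
  "weighted_graphs p m =
    {A \<in> carrier_mat m m. transpose_mat A = A \<and> (\<forall>i<m. \<forall>j<m. A $$ (i, j) \<in> {0..<int p})}"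

definition mat_cong :: "int mat \<Rightarrow> int mat \<Rightarrow> int \<Rightarrow> bool" where
  "mat_cong A B q \<longleftrightarrow> dim_row A = dim_row B \<and> dim_col A = dim_col B \<and>
    (\<forall>i < dim_row A. \<forall>j < dim_col A. [A $$ (i, j) = B $$ (i, j)] (mod q))"

definition is_riordan_graph :: "nat \<Rightarrow> nat \<Rightarrow> int mat \<Rightarrow> bool" where
  "is_riordan_graph p m A \<longleftrightarrow> A \<in> weighted_graphs p m \<and>
    (\<exists>g f :: int fps. fps_nth f 0 = 0 \<and>
      mat_cong A
        (leading_principal (riordan_matrix (fps_X * g) f) m +
         transpose_mat (leading_principal (riordan_matrix (fps_X * g) f) m))
        (int p))"

definition riordan_graphs :: "nat \<Rightarrow> nat \<Rightarrow> int mat set" where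
  "riordan_graphs p m = {A. is_riordan_graph p m A}"

section \<open>Riordan words\<close>

text \<open>The letter \<open>a\<^sub>i\<^sub>,\<^sub>j\<close> is encoded as the pair \<open>(i, j)\<close>.\<close>

definition alphabet :: "nat \<Rightarrow> (nat \<times> nat) set" where
  "alphabet p = {(i, j). i < p \<and> j < p}"

text \<open>List positions start at 0, so the letter \<open>w\<^sub>k\<close> is \<open>w ! (k - 1)\<close>.\<close>

definition is_riordan_word :: "nat \<Rightarrow> (nat \<times> nat) list \<Rightarrow> bool" where
  "is_riordan_word p w \<longleftrightarrow> set w \<subseteq> alphabet p \<and>
    (w = [] \<or>
     (\<forall>k \<in> {1..length w}. w ! (k - 1) = (0, 0)) \<or>
     (\<exists>i b. 1 \<le> i \<and> i \<le> length w \<and> 1 \<le> b \<and> b < p \<and>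
        (\<forall>k \<in> {1..<i}. w ! (k - 1) = (0, 0)) \<and> w ! (i - 1) = (b, 0)))"

definition riordan_words :: "nat \<Rightarrow> nat \<Rightarrow> (nat \<times> nat) list set" where
  "riordan_words p n = {w. length w = n \<and> is_riordan_word p w}"

end

theory Submission
  imports Defs
begin

text \<open>
  A \<open>p\<close>-Riordan graph on \<open>n + 1\<close> vertices remembers exactly the series \<open>g f\<^sup>j\<close> modulo \<open>p\<close> and
  modulo \<open>t\<^sup>n\<close> (\<open>riordan_graph_eq_iff\<close>). The only question is how much of the pair \<open>(g, f)\<close> these
  series determine. Let \<open>s\<close> be the order of \<open>g\<close> modulo \<open>p\<close>, cut off at \<open>n\<close>.

  The column \<open>j = 0\<close> determines \<open>g\<close> modulo \<open>(p, t\<^sup>n)\<close>. Since \<open>p\<close> is prime, the leading coefficient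
  of \<open>g\<close> is invertible modulo \<open>p\<close>, so \<open>g\<close> can be cancelled from the column \<open>j = 1\<close> at the cost of
  \<open>s\<close> coefficients; this determines \<open>f\<close> modulo \<open>(p, t\<^sup>n\<^sup>-\<^sup>s)\<close> (\<open>series_cong_mult_cancel\<close>).
  Conversely these two residues determine every \<open>g f\<^sup>j\<close> modulo \<open>(p, t\<^sup>n)\<close>, because the factor
  \<open>t\<^sup>s\<close> in \<open>g\<close> hides the higher coefficients of \<open>f\<close> (\<open>series_cong_mult\<close>).

  A Riordan word is a way of writing down such a pair of residues: the first components of its
  letters are the coefficients of \<open>g\<close>, and the second components are those of \<open>t\<^sup>s f\<close>. Before
  position \<open>s\<close> both vanish; at position \<open>s\<close> there is the leading coefficient of \<open>g\<close>, together with
  the zero constant term of \<open>f\<close>; afterwards both components are free. If \<open>g\<close> vanishes modulo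
  \<open>(p, t\<^sup>n)\<close>, then \<open>s = n\<close>, nothing of \<open>f\<close> remains, and the word consists of zero letters. Hence
  sending a word to the graph of its pair is a bijection.
\<close>

section \<open>Congruence of truncated power series\<close>

definition series_cong :: "nat \<Rightarrow> nat \<Rightarrow> int fps \<Rightarrow> int fps \<Rightarrow> bool" where
  "series_cong p n a b \<longleftrightarrow> (\<forall>k<n. [fps_nth a k = fps_nth b k] (mod int p))"

text \<open>A factor of order at least \<open>s\<close> makes the product insensitive to the last \<open>s\<close> coefficients of
  the other factor: in the convolution for an index below \<open>n\<close>, every term involving such a
  coefficient is multiplied by one of the first \<open>s\<close> coefficients of \<open>a\<close>.\<close>

lemma series_cong_mult:
  assumes order: "series_cong p s a 0"
    and a: "series_cong p n a a'" and b: "series_cong p (n - s) b b'" and "s \<le> n"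
  shows "series_cong p n (a * b) (a' * b')"
  unfolding series_cong_def
proof (intro allI impI)
  fix k assume k: "k < n"
  have "[fps_nth a i * fps_nth b (k - i) = fps_nth a' i * fps_nth b' (k - i)] (mod int p)"
    if i: "i \<in> {0..k}" for i
  proof (cases "i < s")
    case True
    have a0: "[fps_nth a i = 0] (mod int p)" using order True by (simp add: series_cong_def)
    moreover have "[fps_nth a i = fps_nth a' i] (mod int p)"
      using a i k by (simp add: series_cong_def)
    ultimately have "[fps_nth a' i = 0] (mod int p)" using cong_sym cong_trans by blast
    with a0 show ?thesis by (simp add: cong_0_iff cong_iff_dvd_diff)
  next
    case False
    with i k have "i < n" "k - i < n - s" by auto
    with a b show ?thesis by (auto simp: series_cong_def intro: cong_mult)
  qed
  then show "[fps_nth (a * b) k = fps_nth (a' * b') k] (mod int p)"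
    unfolding fps_mult_nth by (intro cong_sum) auto
qed

lemma series_cong_power:
  assumes "series_cong p n a b"
  shows "series_cong p n (a ^ j) (b ^ j)"
proof (induction j)
  case 0
  show ?case by (simp add: series_cong_def)
next
  case (Suc j)
  show ?case
    using series_cong_mult[of p 0 a n b "a ^ j" "b ^ j"] assms Suc by (simp add: series_cong_def)
qed

text \<open>The coefficients of the quotient are recovered one at a time. In the coefficient of index
  \<open>s + k\<close>, the terms with earlier coefficients of \<open>a\<close> vanish modulo \<open>p\<close> by the order of \<open>a\<close> and
  those with later ones vanish by induction, so only the invertible leading coefficient times the
  \<open>k\<close>-th difference is left.\<close>

lemma series_cong_mult_cancel:
  assumes p: "prime p"
    and order: "series_cong p s a 0" and lead: "\<not> [fps_nth a s = 0] (mod int p)"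
    and prod: "series_cong p n (a * b) (a * b')"
  shows "series_cong p (n - s) b b'"
  unfolding series_cong_def
proof (intro allI impI)
  fix k assume "k < n - s"
  define d where "d = b - b'"
  have "int p dvd fps_nth d k"
    using \<open>k < n - s\<close>
  proof (induction k rule: less_induct)
    case (less k)
    have rest: "int p dvd (\<Sum>i\<in>{0..s + k} - {s}. fps_nth a i * fps_nth d (s + k - i))"
    proof (rule dvd_sum)
      fix i assume i: "i \<in> {0..s + k} - {s}"
      show "int p dvd fps_nth a i * fps_nth d (s + k - i)"
      proof (cases "i < s")
        case True
        with order show ?thesis by (simp add: series_cong_def cong_0_iff)
      next
        case False
        with i have "s + k - i < k" by auto
        with less show ?thesis by (intro dvd_mult) auto
      qed
    qed
    have "[fps_nth (a * b) (s + k) = fps_nth (a * b') (s + k)] (mod int p)"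
      using prod less.prems by (simp add: series_cong_def)
    then have "int p dvd fps_nth (a * d) (s + k)"
      by (simp add: d_def right_diff_distrib cong_iff_dvd_diff)
    also have "fps_nth (a * d) (s + k) = fps_nth a s * fps_nth d k +
        (\<Sum>i\<in>{0..s + k} - {s}. fps_nth a i * fps_nth d (s + k - i))"
      unfolding fps_mult_nth by (subst sum.remove[of _ s]) auto
    finally have "int p dvd fps_nth a s * fps_nth d k"
      using rest by (simp add: dvd_add_left_iff)
    with p lead show ?case by (simp add: prime_dvd_mult_iff cong_0_iff)
  qed
  then show "[fps_nth b k = fps_nth b' k] (mod int p)" by (simp add: d_def cong_iff_dvd_diff)
qed

section \<open>The graph of a pair of series\<close>

definition riordan_graph :: "nat \<Rightarrow> nat \<Rightarrow> int fps \<Rightarrow> int fps \<Rightarrow> int mat" where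
  "riordan_graph p m g f = mat m m (\<lambda>(i, j).
    (riordan_matrix (fps_X * g) f i j + riordan_matrix (fps_X * g) f j i) mod int p)"

lemma riordan_graphs_eq:
  assumes "p > 0"
  shows "riordan_graphs p m = {riordan_graph p m g f | g f. fps_nth f 0 = 0}"
proof (intro equalityI subsetI)
  fix A assume "A \<in> riordan_graphs p m"
  then obtain g f where A: "A \<in> weighted_graphs p m" and f: "fps_nth f 0 = 0"
    and c: "mat_cong A (leading_principal (riordan_matrix (fps_X * g) f) m +
         transpose_mat (leading_principal (riordan_matrix (fps_X * g) f) m)) (int p)"
    unfolding riordan_graphs_def is_riordan_graph_def by blast
  from A have dim: "dim_row A = m" "dim_col A = m"
    and range: "\<And>i j. i < m \<Longrightarrow> j < m \<Longrightarrow> A $$ (i, j) \<in> {0..<int p}"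
    unfolding weighted_graphs_def by blast+
  have "A = riordan_graph p m g f"
  proof (rule eq_matI)
    fix i j
    assume "i < dim_row (riordan_graph p m g f)" "j < dim_col (riordan_graph p m g f)"
    then have ij: "i < m" "j < m" by (simp_all add: riordan_graph_def)
    have "A $$ (i, j) mod int p = A $$ (i, j)"
      using range[OF ij] by (intro mod_pos_pos_trivial) auto
    moreover have "[A $$ (i, j) = riordan_matrix (fps_X * g) f i j +
        riordan_matrix (fps_X * g) f j i] (mod int p)"
      using c ij unfolding mat_cong_def by (simp add: dim leading_principal_def)
    ultimately show "A $$ (i, j) = riordan_graph p m g f $$ (i, j)"
      using ij by (simp add: riordan_graph_def cong_def)
  qed (simp_all add: riordan_graph_def dim)
  with f show "A \<in> {riordan_graph p m g f | g f. fps_nth f 0 = 0}" by blast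
next
  fix A assume "A \<in> {riordan_graph p m g f | g f. fps_nth f 0 = 0}"
  then obtain g f where A: "A = riordan_graph p m g f" and f: "fps_nth f 0 = 0" by blast
  have "A \<in> weighted_graphs p m"
    using assms by (auto simp: A weighted_graphs_def riordan_graph_def add.commute)
  moreover have "mat_cong A (leading_principal (riordan_matrix (fps_X * g) f) m +
         transpose_mat (leading_principal (riordan_matrix (fps_X * g) f) m)) (int p)"
    by (auto simp: A mat_cong_def riordan_graph_def leading_principal_def)
  ultimately show "A \<in> riordan_graphs p m"
    unfolding riordan_graphs_def is_riordan_graph_def using f by blast
qed

lemma mult_power_nth_eq_0:
  fixes g f :: "int fps"
  assumes "fps_nth f 0 = 0" "i < j"
  shows "fps_nth (g * f ^ j) i = 0"
  unfolding fps_mult_nth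
proof (rule sum.neutral, intro ballI)
  fix l assume "l \<in> {0..i}"
  with assms(2) have "i - l < j" by auto
  then show "fps_nth g l * fps_nth (f ^ j) (i - l) = 0"
    using startsby_zero_power_prefix[OF assms(1)] by simp
qed

lemma riordan_matrix_fps_X_mult:
  "riordan_matrix (fps_X * g) f i j = (if i = 0 then 0 else fps_nth (g * f ^ j) (i - 1))"
  by (simp add: riordan_matrix_def mult.assoc)

text \<open>The matrix of \<open>(t g, f)\<close> is strictly lower triangular, so it does not overlap its transpose
  and can be read off from the sum of the two. The missing entries above the diagonal carry no
  information: they vanish for every \<open>f\<close> with zero constant term.\<close>

lemma riordan_graph_eq_iff:
  assumes f: "fps_nth f 0 = 0" and f': "fps_nth f' 0 = 0"
  shows "riordan_graph p (n + 1) g f = riordan_graph p (n + 1) g' f' \<longleftrightarrow>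
    (\<forall>j. series_cong p n (g * f ^ j) (g' * f' ^ j))"
proof
  assume eq: "riordan_graph p (n + 1) g f = riordan_graph p (n + 1) g' f'"
  show "\<forall>j. series_cong p n (g * f ^ j) (g' * f' ^ j)"
    unfolding series_cong_def
  proof (intro allI impI)
    fix j k assume k: "k < n"
    show "[fps_nth (g * f ^ j) k = fps_nth (g' * f' ^ j) k] (mod int p)"
    proof (cases "k < j")
      case True
      then show ?thesis using f f' by (simp add: mult_power_nth_eq_0)
    next
      case False
      then have j: "j \<le> k" by simp
      have "riordan_graph p (n + 1) g f $$ (k + 1, j) = riordan_graph p (n + 1) g' f' $$ (k + 1, j)"
        by (simp only: eq)
      moreover have "j - Suc 0 < Suc k" using j by simp
      ultimately show ?thesis
        using j k f f' mult_power_nth_eq_0[of f "j - Suc 0" "Suc k" g]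
          mult_power_nth_eq_0[of f' "j - Suc 0" "Suc k" g']
        by (simp add: riordan_graph_def riordan_matrix_fps_X_mult cong_def split: if_splits)
    qed
  qed
next
  assume "\<forall>j. series_cong p n (g * f ^ j) (g' * f' ^ j)"
  then have entry: "[riordan_matrix (fps_X * g) f i j = riordan_matrix (fps_X * g') f' i j] (mod int p)"
    if "i < n + 1" for i j
    using that by (auto simp: riordan_matrix_fps_X_mult series_cong_def)
  show "riordan_graph p (n + 1) g f = riordan_graph p (n + 1) g' f'"
    unfolding riordan_graph_def
  proof (rule cong_mat, goal_cases)
    case (3 i j)
    then show ?case using cong_add[OF entry entry] by (simp only: prod.case cong_def)
  qed simp_all
qed

section \<open>The pair of series of a word\<close>

definition word_g :: "(nat \<times> nat) list \<Rightarrow> int fps" where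
  "word_g w = Abs_fps (\<lambda>k. if k < length w then int (fst (w ! k)) else 0)"

definition word_f :: "(nat \<times> nat) list \<Rightarrow> int fps" where
  "word_f w = fps_shift (subdegree (word_g w))
    (Abs_fps (\<lambda>k. if k < length w then int (snd (w ! k)) else 0))"

text \<open>The number \<open>s\<close> is the order of \<open>g\<close>. Allowing \<open>s = length w\<close> covers the zero word and the
  empty word without a case distinction.\<close>

definition has_word_order :: "nat \<Rightarrow> (nat \<times> nat) list \<Rightarrow> bool" where
  "has_word_order s w \<longleftrightarrow> s \<le> length w \<and> (\<forall>k<s. w ! k = (0, 0)) \<and>
    (s < length w \<longrightarrow> fst (w ! s) \<noteq> 0 \<and> snd (w ! s) = 0)"

lemma is_riordan_word_iff:
  "is_riordan_word p w \<longleftrightarrow> set w \<subseteq> alphabet p \<and> (\<exists>s. has_word_order s w)"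
proof (intro iffI conjI)
  assume w: "is_riordan_word p w"
  then show "set w \<subseteq> alphabet p" by (simp add: is_riordan_word_def)
  consider (empty) "w = []" | (zero) "\<forall>k\<in>{1..length w}. w ! (k - 1) = (0, 0)"
    | (lead) i b where "1 \<le> i" "i \<le> length w" "1 \<le> b"
        "\<forall>k\<in>{1..<i}. w ! (k - 1) = (0, 0)" "w ! (i - 1) = (b, 0)"
    using w unfolding is_riordan_word_def by blast
  then show "\<exists>s. has_word_order s w"
  proof cases
    case empty
    then show ?thesis by (simp add: has_word_order_def)
  next
    case zero
    have "w ! k = (0, 0)" if "k < length w" for k
      using zero[rule_format, of "k + 1"] that by simp
    then have "has_word_order (length w) w" by (simp add: has_word_order_def)
    then show ?thesis ..
  next
    case lead
    have "w ! k = (0, 0)" if "k < i - 1" for k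
      using lead(4)[rule_format, of "k + 1"] that by simp
    with lead have "has_word_order (i - 1) w" by (simp add: has_word_order_def)
    then show ?thesis ..
  qed
next
  assume w: "set w \<subseteq> alphabet p \<and> (\<exists>s. has_word_order s w)"
  then obtain s where s: "has_word_order s w" by blast
  show "is_riordan_word p w"
  proof (cases "s < length w")
    case True
    have "w ! s \<in> alphabet p" using w True by (meson nth_mem subsetD)
    moreover obtain b where b: "w ! s = (b, 0)" "b \<noteq> 0"
      using s True by (cases "w ! s") (auto simp: has_word_order_def)
    ultimately have "1 \<le> b \<and> b < p" by (simp add: alphabet_def)
    with b s True have "1 \<le> s + 1 \<and> s + 1 \<le> length w \<and> 1 \<le> b \<and> b < p \<and>
        (\<forall>k\<in>{1..<s + 1}. w ! (k - 1) = (0, 0)) \<and> w ! (s + 1 - 1) = (b, 0)"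
      by (auto simp: has_word_order_def)
    with w show ?thesis unfolding is_riordan_word_def by blast
  next
    case False
    with s w show ?thesis by (auto simp: is_riordan_word_def has_word_order_def)
  qed
qed

lemma has_word_order_word_g:
  assumes "has_word_order s w" "set w \<subseteq> alphabet p"
  shows "series_cong p s (word_g w) 0"
    and "s < length w \<Longrightarrow> \<not> [fps_nth (word_g w) s = 0] (mod int p)"
    and "s < length w \<Longrightarrow> subdegree (word_g w) = s"
proof -
  show "series_cong p s (word_g w) 0"
    using assms(1) by (auto simp: series_cong_def word_g_def has_word_order_def)
  assume s: "s < length w"
  have "w ! s \<in> alphabet p" using assms(2) s by (meson nth_mem subsetD)
  then have "fst (w ! s) < p" by (auto simp: alphabet_def)
  with assms(1) s show "\<not> [fps_nth (word_g w) s = 0] (mod int p)"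
    by (simp add: word_g_def has_word_order_def cong_def)
  show "subdegree (word_g w) = s"
    using assms(1) s by (intro subdegreeI) (auto simp: word_g_def has_word_order_def)
qed

lemma word_f_nth:
  assumes "has_word_order s w" "set w \<subseteq> alphabet p" "k < length w - s"
  shows "fps_nth (word_f w) k = int (snd (w ! (s + k)))"
  using assms has_word_order_word_g(3)[OF assms(1,2)] by (simp add: word_f_def add.commute)

lemma word_f_nth_0:
  assumes "has_word_order s w" "set w \<subseteq> alphabet p"
  shows "fps_nth (word_f w) 0 = 0"
proof (cases "s < length w")
  case True
  with word_f_nth[OF assms, of 0] assms(1) show ?thesis by (simp add: has_word_order_def)
next
  case False
  with assms(1) show ?thesis by (simp add: word_f_def has_word_order_def)
qed

section \<open>The bijection\<close>

lemma inj_on_word_graph: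
  assumes "prime p"
  shows "inj_on (\<lambda>w. riordan_graph p (n + 1) (word_g w) (word_f w)) (riordan_words p n)"
proof (rule inj_onI)
  fix v w
  assume v: "v \<in> riordan_words p n" and w: "w \<in> riordan_words p n"
    and eq: "riordan_graph p (n + 1) (word_g v) (word_f v) =
      riordan_graph p (n + 1) (word_g w) (word_f w)"
  from v w have len: "length v = n" "length w = n"
    and alph: "set v \<subseteq> alphabet p" "set w \<subseteq> alphabet p"
    by (auto simp: riordan_words_def is_riordan_word_iff)
  from v w obtain s s' where s: "has_word_order s v" and s': "has_word_order s' w"
    by (auto simp: riordan_words_def is_riordan_word_iff)
  have col: "series_cong p n (word_g v * word_f v ^ j) (word_g w * word_f w ^ j)" for j
    using eq riordan_graph_eq_iff[OF word_f_nth_0[OF s alph(1)] word_f_nth_0[OF s' alph(2)]]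
    by blast
  have bound: "fst (v ! k) < p" "snd (v ! k) < p" "fst (w ! k) < p" "snd (w ! k) < p"
    if "k < n" for k
  proof -
    have "v ! k \<in> set v" "w ! k \<in> set w" using that len by simp_all
    then have "v ! k \<in> alphabet p" "w ! k \<in> alphabet p" using alph by blast+
    then show "fst (v ! k) < p" "snd (v ! k) < p" "fst (w ! k) < p" "snd (w ! k) < p"
      by (auto simp: alphabet_def)
  qed
  have fst_eq: "fst (v ! k) = fst (w ! k)" if "k < n" for k
  proof (rule cong_less_modulus_unique_nat)
    show "[fst (v ! k) = fst (w ! k)] (mod p)"
      using col[of 0] that len by (simp add: series_cong_def word_g_def cong_int_iff)
  qed (use bound that in simp_all)
  have "word_g v = word_g w" by (rule fps_ext) (simp add: word_g_def len fst_eq)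
  have "s = s'"
  proof (rule linorder_cases[of s s'])
    assume "s < s'"
    with s s' len fst_eq[of s] show ?thesis by (simp add: has_word_order_def)
  next
    assume "s' < s"
    with s s' len fst_eq[of s'] show ?thesis by (simp add: has_word_order_def)
  qed
  have "snd (v ! k) = snd (w ! k)" if k: "k < n" for k
  proof (cases "k < s")
    case True
    with s s' \<open>s = s'\<close> show ?thesis by (simp add: has_word_order_def)
  next
    case False
    with k len have "s < length v" by simp
    have "series_cong p (n - s) (word_f v) (word_f w)"
    proof (rule series_cong_mult_cancel[OF assms])
      show "series_cong p s (word_g v) 0" by (rule has_word_order_word_g(1)[OF s alph(1)])
      show "\<not> [fps_nth (word_g v) s = 0] (mod int p)"
        by (rule has_word_order_word_g(2)[OF s alph(1) \<open>s < length v\<close>])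
      show "series_cong p n (word_g v * word_f v) (word_g v * word_f w)"
        using col[of 1] \<open>word_g v = word_g w\<close> by simp
    qed
    moreover have "k - s < n - s" using False k by simp
    ultimately have "[fps_nth (word_f v) (k - s) = fps_nth (word_f w) (k - s)] (mod int p)"
      by (simp add: series_cong_def)
    then have "[snd (v ! k) = snd (w ! k)] (mod p)"
      using word_f_nth[OF s alph(1), of "k - s"] word_f_nth[OF s' alph(2), of "k - s"]
        \<open>s = s'\<close> False k len
      by (simp add: cong_int_iff)
    with bound[OF k] show ?thesis by (intro cong_less_modulus_unique_nat)
  qed
  with fst_eq len show "v = w" by (intro nth_equalityI) (auto simp: prod_eq_iff)
qed

text \<open>Any pair \<open>(g, f)\<close> can be normalised without changing its graph: reduce modulo \<open>p\<close>, and keep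
  only the coefficients of \<open>g\<close> below \<open>n\<close> and those of \<open>f\<close> below \<open>n - s\<close>. The result is the pair
  of a word.\<close>

lemma ex_word_graph_eq:
  assumes p: "p > 0" and f: "fps_nth f 0 = 0"
  shows "\<exists>w \<in> riordan_words p n.
    riordan_graph p (n + 1) g f = riordan_graph p (n + 1) (word_g w) (word_f w)"
proof -
  define s where "s = (LEAST k. k = n \<or> \<not> [fps_nth g k = 0] (mod int p))"
  have s: "s = n \<or> \<not> [fps_nth g s = 0] (mod int p)" unfolding s_def by (rule LeastI[of _ n]) simp
  have "s \<le> n" unfolding s_def by (rule Least_le) simp
  have g0: "[fps_nth g k = 0] (mod int p)" if "k < s" for k
    using not_less_Least[OF that[unfolded s_def]] by blast
  define w where "w = map (\<lambda>k. (nat (fps_nth g k mod int p),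
      if k < s then 0 else nat (fps_nth f (k - s) mod int p))) [0..<n]"
  have len: "length w = n" by (simp add: w_def)
  have wk: "w ! k = (nat (fps_nth g k mod int p),
      if k < s then 0 else nat (fps_nth f (k - s) mod int p))" if "k < n" for k
    using that by (simp add: w_def)
  have "nat (x mod int p) < p" for x using p by (simp add: nat_less_iff)
  then have alph: "set w \<subseteq> alphabet p" using p by (auto simp: w_def alphabet_def)
  have order: "has_word_order s w"
    unfolding has_word_order_def
  proof (intro conjI allI impI)
    show "s \<le> length w" using \<open>s \<le> n\<close> len by simp
    show "w ! k = (0, 0)" if "k < s" for k
      using that g0[OF that] \<open>s \<le> n\<close> by (simp add: wk cong_def)
    assume "s < length w"
    then have "s < n" using len by simp
    with s have "fps_nth g s mod int p \<noteq> 0" by (simp add: cong_def)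
    moreover have "0 \<le> fps_nth g s mod int p" using p by simp
    ultimately have "0 < fps_nth g s mod int p" by linarith
    then show "fst (w ! s) \<noteq> 0" using \<open>s < n\<close> by (simp add: wk)
    show "snd (w ! s) = 0" using f \<open>s < n\<close> by (simp add: wk)
  qed
  have "series_cong p n g (word_g w)"
    using p by (auto simp: series_cong_def word_g_def len wk cong_def)
  moreover have "series_cong p (n - s) f (word_f w)"
    using p word_f_nth[OF order alph] by (auto simp: series_cong_def len wk cong_def)
  moreover have "series_cong p s g 0" using g0 by (simp add: series_cong_def)
  ultimately have "series_cong p n (g * f ^ j) (word_g w * word_f w ^ j)" for j
    using \<open>s \<le> n\<close> by (intro series_cong_mult series_cong_power)
  then have "riordan_graph p (n + 1) g f = riordan_graph p (n + 1) (word_g w) (word_f w)"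
    using riordan_graph_eq_iff[OF f word_f_nth_0[OF order alph]] by blast
  moreover have "w \<in> riordan_words p n"
    using len alph order by (auto simp: riordan_words_def is_riordan_word_iff)
  ultimately show ?thesis by blast
qed

theorem theorem2p1:
  fixes p n :: nat
  assumes "Factorial_Ring.prime p"
  shows "\<exists>\<phi>. bij_betw \<phi> (riordan_graphs p (n + 1)) (riordan_words p n)"
proof -
  define \<psi> where "\<psi> = (\<lambda>w. riordan_graph p (n + 1) (word_g w) (word_f w))"
  have p: "p > 0" using assms by (rule prime_gt_0_nat)
  have "\<psi> ` riordan_words p n = riordan_graphs p (n + 1)"
  proof
    show "\<psi> ` riordan_words p n \<subseteq> riordan_graphs p (n + 1)"
      using word_f_nth_0
      by (fastforce simp: \<psi>_def riordan_graphs_eq[OF p] riordan_words_def is_riordan_word_iff)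
    show "riordan_graphs p (n + 1) \<subseteq> \<psi> ` riordan_words p n"
      using ex_word_graph_eq[OF p] by (auto simp: \<psi>_def riordan_graphs_eq[OF p] image_iff)
  qed
  then have "bij_betw \<psi> (riordan_words p n) (riordan_graphs p (n + 1))"
    using inj_on_word_graph[OF assms] by (simp add: bij_betw_def \<psi>_def)
  then show ?thesis using bij_betw_inv by blast
qed

end
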